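(* If $x_0>0$ and $\mathrm{Im}(t(x_0))>0$, then $t$ and $f$ can be expanded as $$t(x)=\sum_{k=0}^{+\infty}a_k(x-x_0)^k,\qquad f(x)=\sum_{k=0}^{+\infty}b_k(x-x_0)^k$$ when $|x-x_0|$ is small enough ($x$ real).
   Context: $M,N,L\ge1$ are integers, $c=ML/N$, and $R$ is an $M\times M$ Hermitian matrix with $aI_M\le R<bI_M$, $0<a<b$. For $z\in\mathbb{C}^+$ (open upper half plane), $t(z)$ is the unique solution with $t(z)\in\mathbb{C}^+$, $zt(z)\in\mathbb{C}^+$ of $t(z)=\frac1M\mathrm{Tr}\,R\left(-zI_M-\frac{zct(z)}{1-zc^2t(z)^2}R\right)^{-1}$. For $x>0$, $t(x)=\lim_{z\to x,\,z\in\mathbb{C}^+}t(z)$ (this limit exists and is finite), and $f(x)=\frac1\pi\mathrm{Im}(t(x))$, which is the density on $(0,\infty)$ of the positive measure whose Stieltjes transform is $t$. *)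

theory Defs
  imports "HOL-Analysis.Analysis"
begin

definition upper_half_plane :: "complex set" where
  "upper_half_plane = {z. Im z > 0}"

definition hermitian :: "complex ^ 'm ^ 'm \<Rightarrow> bool" where
  "hermitian A \<longleftrightarrow> (\<forall>i j. A $ i $ j = cnj (A $ j $ i))"

definition hermitian_form :: "complex ^ 'm ^ 'm \<Rightarrow> complex ^ 'm \<Rightarrow> complex" where
  "hermitian_form A v = (\<Sum>i\<in>UNIV. cnj (v $ i) * (A *v v) $ i)"

(* The form of a Hermitian matrix is real-valued, so taking Re below loses nothing. *)

definition loewner_le :: "complex ^ 'm ^ 'm \<Rightarrow> complex ^ 'm ^ 'm \<Rightarrow> bool" where
  "loewner_le A B \<longleftrightarrow> hermitian (B - A) \<and> (\<forall>v. 0 \<le> Re (hermitian_form (B - A) v))"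

definition loewner_less :: "complex ^ 'm ^ 'm \<Rightarrow> complex ^ 'm ^ 'm \<Rightarrow> bool" where
  "loewner_less A B \<longleftrightarrow> hermitian (B - A) \<and> (\<forall>v. v \<noteq> 0 \<longrightarrow> 0 < Re (hermitian_form (B - A) v))"

(* "mat k" is k times the identity, so "mat k ** R" is the scalar multiple k R.
   If w and z * w lie in the upper half plane, then 1 - z c^2 w^2 is nonzero (its vanishing would
   make z * w * w a positive real, but arg (z * w) + arg w lies strictly between 0 and 2 pi), and
   for R positive definite the matrix being inverted is invertible.  Hence the default values of
   division and of matrix_inv never matter. *)

definition is_solution :: "real \<Rightarrow> complex ^ 'm ^ 'm \<Rightarrow> complex \<Rightarrow> complex \<Rightarrow> bool" where
  "is_solution c R z w \<longleftrightarrow>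
     w \<in> upper_half_plane \<and> z * w \<in> upper_half_plane \<and>
     w = 1 / of_nat CARD('m) *
           trace (R ** matrix_inv
             (- mat z - mat (z * of_real c * w / (1 - z * (of_real c)\<^sup>2 * w\<^sup>2)) ** R))"

end

theory Submission
  imports Defs "HOL-Complex_Analysis.Conformal_Mappings"
begin

text \<open>
  The fixed point equation for \<open>w = t(z)\<close> can be solved for \<open>z\<close>, in terms of an auxiliary
  variable. Put \<open>s = c w / (1 - z c\<^sup>2 w\<^sup>2)\<close> and \<open>p(s) = - (1/M) Tr R (I + s R)\<^sup>-\<^sup>1\<close>. The matrix
  being inverted is \<open>- z (I + s R)\<close>, so the equation says \<open>z w = p(s)\<close>, while the definition of
  \<open>s\<close> says \<open>c / s = 1 / w - c\<^sup>2 z w\<close>. Eliminating \<open>w\<close> gives \<open>z = Z(s)\<close> for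
  \<open>Z(s) = p(s) (c / s + c\<^sup>2 p(s))\<close>, a holomorphic function of one variable on the upper half
  plane, and \<open>w = p(s) / z\<close>. Wherever \<open>Z\<close> is invertible, \<open>t(z) = p(Z\<^sup>-\<^sup>1(z)) / z\<close>.

  Let \<open>Im t(x\<^sub>0) > 0\<close>. The parameters \<open>s\<close> that belong to \<open>z\<close> in the upper half plane converge to
  some \<open>s\<^sub>0\<close> as \<open>z \<rightarrow> x\<^sub>0\<close>, and \<open>Im s\<^sub>0 > 0\<close> because \<open>Im t(x\<^sub>0) > 0\<close>; hence
  \<open>Z(s\<^sub>0) = x\<^sub>0\<close>. If \<open>Z'(s\<^sub>0) \<noteq> 0\<close>, then \<open>p(Z\<^sup>-\<^sup>1(z)) / z\<close> is holomorphic near \<open>x\<^sub>0\<close>, agrees with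
  \<open>t\<close> above the real axis, and therefore, both sides being limits from above, on the real axis
  as well. Its Taylor series at \<open>x\<^sub>0\<close> is the required expansion of \<open>t\<close>, and the imaginary parts
  of the coefficients, divided by \<open>\<pi>\<close>, give that of \<open>f\<close>.

  It remains to see that \<open>Z'(s\<^sub>0) \<noteq> 0\<close>. With \<open>X = (I + s R)\<^sup>-\<^sup>1 R\<close> and \<open>q = \<parallel>X\<parallel>\<^sup>2 / M\<close> (Frobenius norm)
  one has \<open>Im p = q Im s\<close> exactly (\<open>Im_neg_mean_trace\<close>), but only \<open>\<bar>p'\<bar> \<le> q\<close>
  (\<open>norm_deriv_neg_mean_trace_le\<close>), since \<open>p' = Tr(X\<^sup>2) / M\<close>. The imaginary part of the equation
  \<open>Z(s\<^sub>0) = x\<^sub>0\<close> then contradicts \<open>Z'(s\<^sub>0) = 0\<close> through a triangle inequality that is strict because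
  \<open>p(s\<^sub>0)\<close> is not real (\<open>parametrization_slope_nonzero\<close>).
\<close>

section \<open>Scalar matrices, adjoints and the Frobenius norm\<close>

lemma mat_nth: "mat s $ i $ j = (if i = j then s else 0)"
  by (simp add: mat_def)

lemma mat_mult_nth [simp]: "(mat s ** A) $ i $ j = s * A $ i $ j"
  for A :: "complex ^ 'n ^ 'm"
  by (simp add: matrix_matrix_mult_def mat_def if_distrib[of "\<lambda>x. x * _"] cong: if_cong)

lemma mult_mat_nth [simp]: "(A ** mat s) $ i $ j = s * A $ i $ j"
  for A :: "complex ^ 'n ^ 'm"
  by (simp add: matrix_matrix_mult_def mat_def if_distrib[of "\<lambda>x. _ * x"] mult.commute cong: if_cong)

lemma mat_mult_commute: "A ** mat s = mat s ** A" for A :: "complex ^ 'n ^ 'n"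
  by (simp add: vec_eq_iff)

lemma matrix_add_rdistrib: "(A + B) ** C = A ** C + B ** C" for A :: "complex ^ 'n ^ 'm"
  by (simp add: vec_eq_iff matrix_matrix_mult_def algebra_simps sum.distrib)

lemma matrix_diff_ldistrib: "A ** (B - C) = A ** B - A ** C" for A :: "complex ^ 'n ^ 'm"
  by (simp add: vec_eq_iff matrix_matrix_mult_def algebra_simps sum_subtractf)

lemma matrix_inv_unique:
  fixes A :: "complex ^ 'n ^ 'n"
  assumes "A ** B = mat 1"
  shows "matrix_inv A = B"
proof -
  have "B ** A = mat 1"
    using assms matrix_left_right_inverse by blast
  then have ex: "\<exists>C. A ** C = mat 1 \<and> C ** A = mat 1"
    using assms by blast
  then have "A ** matrix_inv A = mat 1 \<and> matrix_inv A ** A = mat 1"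
    unfolding matrix_inv_def by (rule someI_ex)
  then have "matrix_inv A ** A = mat 1" ..
  then have "(matrix_inv A ** A) ** B = B"
    by simp
  then show ?thesis
    by (simp add: assms flip: matrix_mul_assoc)
qed

definition adjoint_matrix :: "complex ^ 'n ^ 'm \<Rightarrow> complex ^ 'm ^ 'n" where
  "adjoint_matrix A = (\<chi> i j. cnj (A $ j $ i))"

lemma adjoint_matrix_mult: "adjoint_matrix (A ** B) = adjoint_matrix B ** adjoint_matrix A"
  by (simp add: adjoint_matrix_def vec_eq_iff matrix_matrix_mult_def mult.commute)

lemma adjoint_matrix_add: "adjoint_matrix (A + B) = adjoint_matrix A + adjoint_matrix B"
  by (simp add: adjoint_matrix_def vec_eq_iff)

lemma adjoint_matrix_mat: "adjoint_matrix (mat s) = mat (cnj s)"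
  by (simp add: adjoint_matrix_def vec_eq_iff mat_def)

lemma hermitian_iff_adjoint: "hermitian A \<longleftrightarrow> adjoint_matrix A = A"
  unfolding hermitian_def adjoint_matrix_def vec_eq_iff vec_lambda_beta by metis

lemma trace_mat_mult: "trace (mat s ** A) = s * trace A" for A :: "complex ^ 'n ^ 'n"
  by (simp add: trace_def sum_distrib_left)

lemma Im_trace_adjoint: "Im (trace (adjoint_matrix A)) = - Im (trace A)"
  by (simp add: trace_def adjoint_matrix_def sum_negf)

lemma norm_matrix_squared: "(norm A)\<^sup>2 = (\<Sum>i\<in>UNIV. \<Sum>j\<in>UNIV. (cmod (A $ i $ j))\<^sup>2)"
  for A :: "complex ^ 'n ^ 'm"
  by (simp add: norm_vec_def L2_set_def sum_nonneg)

lemma trace_adjoint_mult_self: "trace (adjoint_matrix A ** A) = of_real ((norm A)\<^sup>2)"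
  for A :: "complex ^ 'n ^ 'm"
proof -
  have "trace (adjoint_matrix A ** A) = (\<Sum>j\<in>UNIV. \<Sum>i\<in>UNIV. of_real ((cmod (A $ i $ j))\<^sup>2))"
    by (simp add: trace_def adjoint_matrix_def matrix_matrix_mult_def complex_norm_square mult.commute del: of_real_power)
  also have "\<dots> = (\<Sum>i\<in>UNIV. \<Sum>j\<in>UNIV. of_real ((cmod (A $ i $ j))\<^sup>2))"
    by (rule sum.swap)
  finally show ?thesis
    by (simp add: norm_matrix_squared)
qed

text \<open>
  This is the Cauchy--Schwarz inequality for the Frobenius inner product of the adjoint of \<open>A\<close> with
  \<open>A\<close>, two matrices of equal norm; the arithmetic-geometric mean inequality on pairs of entries
  is enough here.
\<close>

lemma norm_trace_square_le: "cmod (trace (A ** A)) \<le> (norm A)\<^sup>2"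
  for A :: "complex ^ 'n ^ 'n"
proof -
  have "cmod (trace (A ** A)) \<le> (\<Sum>i\<in>UNIV. cmod (\<Sum>j\<in>UNIV. A $ i $ j * A $ j $ i))"
    unfolding trace_def by (simp add: matrix_matrix_mult_def norm_sum)
  also have "\<dots> \<le> (\<Sum>i\<in>UNIV. \<Sum>j\<in>UNIV. cmod (A $ i $ j) * cmod (A $ j $ i))"
    by (intro sum_mono order_trans[OF norm_sum]) (simp add: norm_mult)
  also have "\<dots> \<le> (\<Sum>i\<in>UNIV. \<Sum>j\<in>UNIV. ((cmod (A $ i $ j))\<^sup>2 + (cmod (A $ j $ i))\<^sup>2) / 2)"
  proof (intro sum_mono)
    fix i j
    show "cmod (A $ i $ j) * cmod (A $ j $ i) \<le> ((cmod (A $ i $ j))\<^sup>2 + (cmod (A $ j $ i))\<^sup>2) / 2"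
      using sum_squares_bound[of "cmod (A $ i $ j)" "cmod (A $ j $ i)"] by simp
  qed
  also have "\<dots> = ((\<Sum>i\<in>UNIV. \<Sum>j\<in>UNIV. (cmod (A $ i $ j))\<^sup>2) + (\<Sum>i\<in>UNIV. \<Sum>j\<in>UNIV. (cmod (A $ j $ i))\<^sup>2)) / 2"
    by (simp add: sum.distrib flip: sum_divide_distrib)
  also have "(\<Sum>i\<in>UNIV. \<Sum>j\<in>UNIV. (cmod (A $ j $ i))\<^sup>2) = (norm A)\<^sup>2"
    unfolding norm_matrix_squared by (rule sum.swap)
  finally show ?thesis
    by (simp add: norm_matrix_squared)
qed

lemma norm_entry_le: "cmod (A $ i $ j) \<le> norm A" for A :: "complex ^ 'n ^ 'm"
  by (meson Finite_Cartesian_Product.norm_nth_le order_trans)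

section \<open>The Yosida approximation of a Hermitian matrix\<close>

text \<open>
  For Hermitian \<open>R\<close> this is the Yosida approximation of \<open>R\<close>. It commutes with \<open>R\<close>, and working with
  it rather than with the resolvent makes the identities below quadratic in a single matrix.
\<close>

definition yosida :: "complex ^ 'm ^ 'm \<Rightarrow> complex \<Rightarrow> complex ^ 'm ^ 'm" where
  "yosida R s = matrix_inv (mat 1 + mat s ** R) ** R"

definition neg_mean_trace :: "complex ^ 'm ^ 'm \<Rightarrow> complex \<Rightarrow> complex" where
  "neg_mean_trace R s = - (1 / of_nat CARD('m)) * trace (yosida R s)"

text \<open>
  The quadratic form of \<open>R\<close> is real, so pairing \<open>v + s R v = 0\<close> with \<open>v\<close> and taking imaginary parts
  forces first the form and then \<open>v\<close> itself to vanish.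
\<close>

lemma invertible_one_plus_hermitian:
  fixes R :: "complex ^ 'm ^ 'm"
  assumes "hermitian R" and "Im s > 0"
  shows "(mat 1 + mat s ** R) ** matrix_inv (mat 1 + mat s ** R) = mat 1"
proof -
  have ker: "v = 0" if v: "(mat 1 + mat s ** R) *v v = 0" for v
  proof -
    define q where "q = hermitian_form R v"
    have cnj_entry: "cnj (R $ i $ j) = R $ j $ i" for i j
      using \<open>hermitian R\<close> unfolding hermitian_def by metis
    have "cnj q = (\<Sum>i\<in>UNIV. \<Sum>j\<in>UNIV. v $ i * (cnj (R $ i $ j) * cnj (v $ j)))"
      by (simp add: q_def hermitian_form_def matrix_vector_mult_def sum_distrib_left)
    also have "\<dots> = (\<Sum>j\<in>UNIV. \<Sum>i\<in>UNIV. v $ i * (cnj (R $ i $ j) * cnj (v $ j)))"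
      by (rule sum.swap)
    also have "\<dots> = q"
      by (simp add: q_def hermitian_form_def matrix_vector_mult_def sum_distrib_left cnj_entry mult_ac)
    finally have q_real: "Im q = 0"
      by (simp add: complex_eq_iff)
    have "(mat 1 + mat s ** R) *v v = v + s *s (R *v v)"
      by (simp add: matrix_vector_mult_add_rdistrib)
         (simp add: vec_eq_iff matrix_vector_mult_def sum_distrib_left mult.assoc)
    then have "v $ i + s * (R *v v) $ i = 0" for i
      using v by (metis vector_add_component vector_smult_component zero_index)
    then have "(\<Sum>i\<in>UNIV. cnj (v $ i) * (v $ i + s * (R *v v) $ i)) = 0"
      by simp
    moreover have "(\<Sum>i\<in>UNIV. cnj (v $ i) * (v $ i + s * (R *v v) $ i))
        = of_real (\<Sum>i\<in>UNIV. (cmod (v $ i))\<^sup>2) + s * q"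
      by (simp add: q_def hermitian_form_def complex_norm_square sum.distrib sum_distrib_left
            algebra_simps del: of_real_power)
    ultimately have eq: "of_real (\<Sum>i\<in>UNIV. (cmod (v $ i))\<^sup>2) + s * q = 0"
      by simp
    have "Im (of_real (\<Sum>i\<in>UNIV. (cmod (v $ i))\<^sup>2) + s * q) = Im s * Re q"
      using q_real by simp
    then have "Im s * Re q = 0"
      by (metis eq zero_complex.sel(2))
    then have "Re q = 0"
      using \<open>Im s > 0\<close> by simp
    then have "q = 0"
      using q_real by (simp add: complex_eq_iff)
    then have "(\<Sum>i\<in>UNIV. (cmod (v $ i))\<^sup>2) = 0"
      using eq by (simp del: of_real_sum of_real_power)
    then show "v = 0"
      by (simp add: sum_nonneg_eq_0_iff vec_eq_iff)
  qed
  then obtain B where "B ** (mat 1 + mat s ** R) = mat 1"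
    using matrix_left_invertible_ker by blast
  then have "(mat 1 + mat s ** R) ** B = mat 1"
    using matrix_left_right_inverse by blast
  then show ?thesis
    using matrix_inv_unique by metis
qed

context
  fixes R :: "complex ^ 'm ^ 'm"
  assumes herm: "hermitian R"
begin

lemma yosida_left:
  assumes "Im s > 0"
  shows "yosida R s + mat s ** (R ** yosida R s) = R"
proof -
  have "(mat 1 + mat s ** R) ** yosida R s = R"
    using invertible_one_plus_hermitian[OF herm assms] by (simp add: yosida_def matrix_mul_assoc)
  then show ?thesis
    by (simp add: matrix_add_rdistrib matrix_mul_assoc)
qed

text \<open>
  The resolvent identity: it yields continuity of the entries once they are bounded, and the
  derivative \<open>- X\<^sup>2\<close> after that.
\<close>

lemma yosida_diff:
  assumes "Im s > 0" and "Im u > 0"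
  shows "yosida R s - yosida R u = mat (u - s) ** (yosida R s ** yosida R u)"
proof -
  define G where "G = matrix_inv (mat 1 + mat s ** R)"
  have G: "G ** (mat 1 + mat s ** R) = mat 1"
    using invertible_one_plus_hermitian[OF herm assms(1)] matrix_left_right_inverse
    unfolding G_def by blast
  have "(mat 1 + mat s ** R) ** (yosida R s - yosida R u)
      = (yosida R s + mat s ** (R ** yosida R s)) - (yosida R u + mat s ** (R ** yosida R u))"
    by (simp add: matrix_add_rdistrib matrix_diff_ldistrib matrix_mul_assoc)
  also have "\<dots> = (yosida R u + mat u ** (R ** yosida R u)) - (yosida R u + mat s ** (R ** yosida R u))"
    by (simp only: yosida_left assms)
  also have "\<dots> = mat (u - s) ** (R ** yosida R u)"
    by (simp add: vec_eq_iff algebra_simps)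
  finally have "G ** ((mat 1 + mat s ** R) ** (yosida R s - yosida R u))
      = G ** (mat (u - s) ** (R ** yosida R u))"
    by simp
  also have "\<dots> = mat (u - s) ** (yosida R s ** yosida R u)"
    by (simp add: yosida_def G_def matrix_mul_assoc mat_mult_commute)
  finally show ?thesis
    by (simp add: matrix_mul_assoc G)
qed

text \<open>
  The matrix form of \<open>Im (\<lambda> / (1 + s \<lambda>)) = - Im s \<bar>\<lambda> / (1 + s \<lambda>)\<bar>\<^sup>2\<close>, valid for each real eigenvalue
  \<open>\<lambda>\<close> of \<open>R\<close>. It is obtained without diagonalizing \<open>R\<close>, from \<open>X + s R X = R\<close> and the adjoint
  of this equation.
\<close>

lemma yosida_adjoint:
  assumes "Im s > 0"
  shows "mat (s - cnj s) ** (adjoint_matrix (yosida R s) ** yosida R s)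
      = adjoint_matrix (yosida R s) - yosida R s"
proof -
  define X where "X = yosida R s"
  define Y where "Y = adjoint_matrix X"
  have X: "X + mat s ** (R ** X) = R"
    using yosida_left[OF assms] by (simp add: X_def)
  have "adjoint_matrix (X + mat s ** (R ** X)) = adjoint_matrix R"
    by (simp add: X)
  then have Y: "Y + mat (cnj s) ** (Y ** R) = R"
    using herm by (simp add: Y_def adjoint_matrix_add adjoint_matrix_mat adjoint_matrix_mult mat_mult_commute hermitian_iff_adjoint)
  have "Y ** X + mat s ** (Y ** R ** X) = Y ** R"
  proof -
    have "Y ** (X + mat s ** (R ** X)) = Y ** R" by (simp add: X)
    then show ?thesis
      by (simp add: matrix_add_ldistrib matrix_mul_assoc mat_mult_commute)
  qed
  moreover have "Y ** X + mat (cnj s) ** (Y ** R ** X) = R ** X"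
  proof -
    have "(Y + mat (cnj s) ** (Y ** R)) ** X = R ** X" by (simp add: Y)
    then show ?thesis
      by (simp add: matrix_add_rdistrib matrix_mul_assoc)
  qed
  moreover have "mat (s - cnj s) ** (Y ** X)
      = mat s ** (Y ** X + mat (cnj s) ** (Y ** R ** X))
        - mat (cnj s) ** (Y ** X + mat s ** (Y ** R ** X))"
    by (simp add: vec_eq_iff algebra_simps)
  ultimately have "mat (s - cnj s) ** (Y ** X) = mat s ** (R ** X) - mat (cnj s) ** (Y ** R)"
    by simp
  \<comment> \<open>Both bracketed expressions equal \<open>R\<close>.\<close>
  also have "\<dots> = (X + mat s ** (R ** X)) - (Y + mat (cnj s) ** (Y ** R)) + (Y - X)"
    by simp
  also have "\<dots> = Y - X"
    by (simp only: X Y) simp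
  finally show ?thesis
    by (simp only: X_def Y_def)
qed

lemma Im_trace_yosida:
  assumes "Im s > 0"
  shows "Im (trace (yosida R s)) = - Im s * (norm (yosida R s))\<^sup>2"
proof -
  have "trace (mat (s - cnj s) ** (adjoint_matrix (yosida R s) ** yosida R s))
      = trace (adjoint_matrix (yosida R s) - yosida R s)"
    by (simp only: yosida_adjoint[OF assms])
  then have "(s - cnj s) * of_real ((norm (yosida R s))\<^sup>2)
      = trace (adjoint_matrix (yosida R s)) - trace (yosida R s)"
    by (simp only: trace_mat_mult trace_sub trace_adjoint_mult_self)
  then have "Im ((s - cnj s) * of_real ((norm (yosida R s))\<^sup>2))
      = Im (trace (adjoint_matrix (yosida R s))) - Im (trace (yosida R s))"
    by simp
  then show ?thesis
    by (simp add: Im_trace_adjoint)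
qed

text \<open>
  The trace is linear in \<open>X\<close> whereas its imaginary part is quadratic by the preceding identity, so
  \<open>X\<close> is bounded locally uniformly in \<open>s\<close>.
\<close>

lemma norm_yosida_le:
  assumes "Im s > 0"
  shows "norm (yosida R s) \<le> real CARD('m) / Im s"
proof (cases "norm (yosida R s) = 0")
  case True
  then show ?thesis
    using assms by simp
next
  case False
  have "Im s * (norm (yosida R s))\<^sup>2 \<le> cmod (trace (yosida R s))"
    using Im_trace_yosida[OF assms] abs_Im_le_cmod[of "trace (yosida R s)"] by linarith
  also have "\<dots> \<le> (\<Sum>i\<in>UNIV. cmod (yosida R s $ i $ i))"
    unfolding trace_def by (rule norm_sum)
  also have "\<dots> \<le> (\<Sum>i\<in>(UNIV :: 'm set). norm (yosida R s))"
    by (intro sum_mono norm_entry_le)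
  finally have "(Im s * norm (yosida R s)) * norm (yosida R s) \<le> real CARD('m) * norm (yosida R s)"
    by (simp add: power2_eq_square mult_ac)
  then have "Im s * norm (yosida R s) \<le> real CARD('m)"
    using False by (simp add: mult_le_cancel_right)
  then show ?thesis
    using assms by (simp add: field_simps)
qed

lemma isCont_yosida_entry:
  assumes u: "Im u > 0"
  shows "isCont (\<lambda>s. yosida R s $ i $ j) u"
proof -
  define C where "C = real CARD('m) / (Im u / 2)"
  have bound: "cmod (yosida R s $ k $ l) \<le> C" if "Im s > Im u / 2" for s k l
  proof -
    have "cmod (yosida R s $ k $ l) \<le> norm (yosida R s)"
      by (rule norm_entry_le)
    also have "\<dots> \<le> real CARD('m) / Im s"
      by (rule norm_yosida_le) (use that u in linarith)
    also have "\<dots> \<le> C"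
      unfolding C_def using that u by (intro divide_left_mono) auto
    finally show ?thesis .
  qed
  have "open {s. Im s > Im u / 2}"
    by (rule open_halfspace_Im_gt)
  then have "eventually (\<lambda>s. s \<in> {s. Im s > Im u / 2}) (at u)"
    using u by (intro eventually_at_in_open') auto
  then have ev: "eventually (\<lambda>s. Im s > Im u / 2) (at u)"
    by simp
  have lipschitz: "cmod (yosida R s $ i $ j - yosida R u $ i $ j) \<le> cmod (u - s) * (real CARD('m) * (C * C))"
    if s: "Im s > Im u / 2" for s
  proof -
    have "Im s > 0" using s u by linarith
    have "yosida R s $ i $ j - yosida R u $ i $ j
        = (u - s) * (\<Sum>k\<in>UNIV. yosida R s $ i $ k * yosida R u $ k $ j)"
    proof -
      have "(yosida R s - yosida R u) $ i $ j = (u - s) * (yosida R s ** yosida R u) $ i $ j"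
        by (simp only: yosida_diff[OF \<open>Im s > 0\<close> u] mat_mult_nth)
      then show ?thesis
        by (simp add: matrix_matrix_mult_def)
    qed
    moreover have "cmod (\<Sum>k\<in>UNIV. yosida R s $ i $ k * yosida R u $ k $ j)
        \<le> (\<Sum>k\<in>(UNIV :: 'm set). C * C)"
      using s u bound[of s] bound[of u]
      by (intro sum_norm_le) (simp add: norm_mult mult_mono')
    ultimately show ?thesis
      by (simp add: norm_mult mult_left_mono)
  qed
  have "((\<lambda>s. cmod (u - s) * (real CARD('m) * (C * C))) \<longlongrightarrow> cmod (u - u) * (real CARD('m) * (C * C))) (at u)"
    by (intro tendsto_intros)
  then have "((\<lambda>s. cmod (u - s) * (real CARD('m) * (C * C))) \<longlongrightarrow> 0) (at u)"
    by simp
  then have "((\<lambda>s. yosida R s $ i $ j - yosida R u $ i $ j) \<longlongrightarrow> 0) (at u)"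
    by (rule Lim_null_comparison[rotated]) (use ev lipschitz in \<open>auto elim!: eventually_mono\<close>)
  then show ?thesis
    unfolding isCont_def by (rule LIM_zero_cancel)
qed

lemma neg_mean_trace_has_derivative:
  assumes u: "Im u > 0"
  shows "(neg_mean_trace R has_field_derivative
           1 / of_nat CARD('m) * trace (yosida R u ** yosida R u)) (at u)"
proof -
  have "open {s. Im s > 0}"
    by (rule open_halfspace_Im_gt)
  then have "eventually (\<lambda>s. s \<in> {s. Im s > 0}) (at u)"
    using u by (intro eventually_at_in_open') auto
  then have ev: "eventually (\<lambda>s. 1 / of_nat CARD('m) * trace (yosida R s ** yosida R u)
      = (neg_mean_trace R s - neg_mean_trace R u) / (s - u)) (at u)"
    using eventually_neq_at_within[of u u]
  proof eventually_elim
    case (elim s)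
    have "trace (yosida R s) - trace (yosida R u) = trace (yosida R s - yosida R u)"
      by (simp add: trace_sub)
    also have "\<dots> = (u - s) * trace (yosida R s ** yosida R u)"
      using elim u by (simp add: yosida_diff trace_mat_mult)
    finally have "neg_mean_trace R s - neg_mean_trace R u
        = 1 / of_nat CARD('m) * ((s - u) * trace (yosida R s ** yosida R u))"
      by (simp add: neg_mean_trace_def field_simps)
    then show ?case
      using elim by simp
  qed
  have "((\<lambda>s. 1 / of_nat CARD('m) * trace (yosida R s ** yosida R u)) \<longlongrightarrow>
      1 / of_nat CARD('m) * trace (yosida R u ** yosida R u)) (at u)"
    unfolding trace_def matrix_matrix_mult_def vec_lambda_beta
    by (intro tendsto_intros isCont_yosida_entry[unfolded isCont_def] u)
  then show ?thesis
    unfolding has_field_derivative_iff by (rule Lim_transform_eventually[OF _ ev])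
qed

text \<open>
  The two facts that drive the argument: the same number \<open>q = \<parallel>X\<parallel>\<^sup>2 / M\<close> is the exact ratio of the
  imaginary parts of \<open>p(s)\<close> and \<open>s\<close>, and a bound for the derivative of \<open>p\<close>.
\<close>

lemma Im_neg_mean_trace:
  assumes "Im s > 0"
  shows "Im (neg_mean_trace R s) = (norm (yosida R s))\<^sup>2 / real CARD('m) * Im s"
proof -
  have "neg_mean_trace R s = - (trace (yosida R s) / of_real (real CARD('m)))"
    by (simp add: neg_mean_trace_def)
  then have "Im (neg_mean_trace R s) = - (Im (trace (yosida R s)) / real CARD('m))"
    by (simp only: Im_divide_of_real uminus_complex.sel)
  then show ?thesis
    by (simp add: Im_trace_yosida[OF assms])
qed

lemma norm_deriv_neg_mean_trace_le:
  assumes "Im s > 0"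
  shows "cmod (deriv (neg_mean_trace R) s) \<le> (norm (yosida R s))\<^sup>2 / real CARD('m)"
proof -
  have "deriv (neg_mean_trace R) s = 1 / of_nat CARD('m) * trace (yosida R s ** yosida R s)"
    by (rule DERIV_imp_deriv[OF neg_mean_trace_has_derivative[OF assms]])
  then show ?thesis
    using norm_trace_square_le[of "yosida R s"] by (simp add: norm_divide divide_right_mono)
qed

lemma neg_mean_trace_holomorphic: "neg_mean_trace R holomorphic_on {s. Im s > 0}"
  using neg_mean_trace_has_derivative open_halfspace_Im_gt[of 0]
  by (auto simp: holomorphic_on_open)

end

section \<open>Solving the fixed point equation for the spectral variable\<close>

text \<open>
  The argument of the trace function in the fixed point equation: the matrix inverted there
  is \<open>- z\<close> times \<open>I + s R\<close>, with \<open>s\<close> given by this formula.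
\<close>

definition spectral_parameter :: "real \<Rightarrow> complex \<Rightarrow> complex \<Rightarrow> complex" where
  "spectral_parameter c z w = of_real c * w / (1 - z * (of_real c)\<^sup>2 * w\<^sup>2)"

text \<open>
  The hypotheses ask for \<open>Im (z w) > 0\<close> and not for \<open>Im z > 0\<close>, so that they cover both a point of the
  upper half plane and a positive real \<open>z\<close> with a boundary value \<open>w\<close> above the real axis. All three
  claims come from writing \<open>s = c / d\<close>: the terms \<open>1 / w\<close> and \<open>- c\<^sup>2 z w\<close> of \<open>d\<close> both lie in the
  lower half plane.
\<close>

lemma spectral_parameter:
  assumes c: "c > 0" and w: "Im w > 0" and zw: "Im (z * w) > 0"
  shows "1 - z * (of_real c)\<^sup>2 * w\<^sup>2 \<noteq> 0"
    and "Im (spectral_parameter c z w) > 0"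
    and "of_real c / spectral_parameter c z w = 1 / w - (of_real c)\<^sup>2 * (z * w)"
proof -
  define d where "d = 1 / w - (of_real c)\<^sup>2 * (z * w)"
  have w0: "w \<noteq> 0"
    using w by auto
  have "Im (of_real (c\<^sup>2) * (z * w)) = c\<^sup>2 * Im (z * w)"
    by (simp del: of_real_power)
  then have "Im ((of_real c)\<^sup>2 * (z * w)) > 0"
    using c zw by (simp add: zero_less_mult_iff)
  moreover have "Im (1 / w) < 0"
    using w w0 by (simp add: Im_divide divide_pos_pos complex_neq_0)
  ultimately have d: "Im d < 0"
    unfolding d_def minus_complex.sel by linarith
  then have d0: "d \<noteq> 0"
    by auto
  have den: "1 - z * (of_real c)\<^sup>2 * w\<^sup>2 = w * d"
    using w0 by (simp add: d_def field_simps power2_eq_square)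
  then show "1 - z * (of_real c)\<^sup>2 * w\<^sup>2 \<noteq> 0"
    using w0 d0 by simp
  have s: "spectral_parameter c z w = of_real c / d"
    using w0 by (simp add: spectral_parameter_def den)
  then have "Im (spectral_parameter c z w) = - (c * Im d) / ((Re d)\<^sup>2 + (Im d)\<^sup>2)"
    by (simp add: Im_divide)
  moreover have "(Re d)\<^sup>2 + (Im d)\<^sup>2 > 0"
    using d0 by (simp add: complex_neq_0)
  moreover have "- (c * Im d) > 0"
    using c d by (simp add: mult_pos_neg)
  ultimately show "Im (spectral_parameter c z w) > 0"
    by (simp add: divide_neg_pos)
  show "of_real c / spectral_parameter c z w = 1 / w - (of_real c)\<^sup>2 * (z * w)"
    using c d0 by (simp add: s flip: d_def)
qed

lemma is_solution_imp_neg_mean_trace: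
  fixes R :: "complex ^ 'm ^ 'm"
  assumes "hermitian R" and "c > 0" and sol: "is_solution c R z w"
  shows "z * w = neg_mean_trace R (spectral_parameter c z w)"
proof -
  define s where "s = spectral_parameter c z w"
  define G where "G = matrix_inv (mat 1 + mat s ** R)"
  have w: "Im w > 0" and zw: "Im (z * w) > 0"
    using sol by (auto simp: is_solution_def upper_half_plane_def)
  then have z0: "z \<noteq> 0"
    by auto
  have "Im s > 0"
    unfolding s_def using spectral_parameter(2)[OF \<open>c > 0\<close> w zw] .
  then have G: "(mat 1 + mat s ** R) ** G = mat 1"
    unfolding G_def by (rule invertible_one_plus_hermitian[OF \<open>hermitian R\<close>])
  have "- mat z - mat (z * of_real c * w / (1 - z * (of_real c)\<^sup>2 * w\<^sup>2)) ** R
      = mat (- z) ** (mat 1 + mat s ** R)"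
    by (simp add: vec_eq_iff s_def spectral_parameter_def mat_nth algebra_simps)
  moreover have "(mat (- z) ** (mat 1 + mat s ** R)) ** (mat (- 1 / z) ** G) = mat 1"
  proof -
    have "(mat (- z) ** (mat 1 + mat s ** R)) ** (mat (- 1 / z) ** G)
        = mat (- z) ** ((mat 1 + mat s ** R) ** mat (- 1 / z)) ** G"
      by (simp only: matrix_mul_assoc)
    also have "\<dots> = mat (- z) ** (mat (- 1 / z) ** (mat 1 + mat s ** R)) ** G"
      by (simp only: mat_mult_commute)
    also have "\<dots> = mat (- z) ** (mat (- 1 / z) ** ((mat 1 + mat s ** R) ** G))"
      by (simp only: matrix_mul_assoc)
    also have "\<dots> = mat 1"
      unfolding G using z0 by (simp add: vec_eq_iff mat_nth)
    finally show ?thesis .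
  qed
  ultimately have "w = 1 / of_nat CARD('m) * trace (R ** (mat (- 1 / z) ** G))"
    using sol by (simp add: is_solution_def matrix_inv_unique)
  also have "trace (R ** (mat (- 1 / z) ** G)) = trace ((mat (- 1 / z) ** G) ** R)"
    by (rule trace_mul_sym)
  also have "\<dots> = - 1 / z * trace (yosida R s)"
    by (simp only: yosida_def G_def trace_mat_mult flip: matrix_mul_assoc)
  finally show ?thesis
    using z0 by (simp add: neg_mean_trace_def s_def field_simps)
qed

text \<open>
  The function \<open>Z\<close>. At the parameter \<open>s\<close> of a solution the second factor is \<open>1 / w\<close> and the first is
  \<open>z w\<close>.
\<close>

definition inverse_parametrization :: "real \<Rightarrow> complex ^ 'm ^ 'm \<Rightarrow> complex \<Rightarrow> complex" where
  "inverse_parametrization c R s =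
     neg_mean_trace R s * (of_real c / s + (of_real c)\<^sup>2 * neg_mean_trace R s)"

lemma inverse_parametrization_spectral_parameter:
  assumes "c > 0" and "Im w > 0" and "Im (z * w) > 0"
    and "z * w = neg_mean_trace R (spectral_parameter c z w)"
  shows "inverse_parametrization c R (spectral_parameter c z w) = z"
proof -
  have "w \<noteq> 0"
    using assms(2) by auto
  moreover have "inverse_parametrization c R (spectral_parameter c z w)
      = (z * w) * ((1 / w - (of_real c)\<^sup>2 * (z * w)) + (of_real c)\<^sup>2 * (z * w))"
    unfolding inverse_parametrization_def assms(4)[symmetric] spectral_parameter(3)[OF assms(1-3)] ..
  ultimately show ?thesis
    by simp
qed

lemma inverse_parametrization_holomorphic:
  assumes "hermitian R"
  shows "inverse_parametrization c R holomorphic_on {s. Im s > 0}"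
  unfolding inverse_parametrization_def
  by (intro holomorphic_intros neg_mean_trace_holomorphic[OF assms]) auto

section \<open>Non-vanishing of the derivative of the parametrization\<close>

lemma cmod_real_add_square_less:
  assumes "x > 0" and "Im v \<noteq> 0"
  shows "cmod (of_real x + v\<^sup>2) < x + (cmod v)\<^sup>2"
proof -
  have "Re (v\<^sup>2) < (cmod v)\<^sup>2"
    using assms(2) by (simp add: cmod_power2 Re_power2)
  moreover have "(cmod (of_real x + v\<^sup>2))\<^sup>2 = x\<^sup>2 + 2 * x * Re (v\<^sup>2) + (cmod (v\<^sup>2))\<^sup>2"
    unfolding cmod_power2 by (simp add: power2_sum)
  ultimately have "(cmod (of_real x + v\<^sup>2))\<^sup>2 < x\<^sup>2 + 2 * x * (cmod v)\<^sup>2 + (cmod (v\<^sup>2))\<^sup>2"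
    using assms(1) by simp
  also have "\<dots> = (x + (cmod v)\<^sup>2)\<^sup>2"
    by (simp add: power2_sum norm_power)
  finally show ?thesis
    using assms(1) by (intro power2_less_imp_less[of _ "x + (cmod v)\<^sup>2"]) auto
qed

text \<open>
  Write \<open>Z = p (c / s + c\<^sup>2 p)\<close> and \<open>d = p'\<close>, and let \<open>Z = x\<close>. Then \<open>Z' = 0\<close> means
  \<open>c p\<^sup>2 = d s\<^sup>2 (x + c\<^sup>2 p\<^sup>2)\<close>, while the imaginary part of \<open>c / s = x / p - c\<^sup>2 p\<close> gives
  \<open>c \<bar>p\<bar>\<^sup>2 = q \<bar>s\<bar>\<^sup>2 (x + c\<^sup>2 \<bar>p\<bar>\<^sup>2)\<close>. Since \<open>\<bar>d\<bar> \<le> q\<close> and \<open>\<bar>x + c\<^sup>2 p\<^sup>2\<bar> < x + c\<^sup>2 \<bar>p\<bar>\<^sup>2\<close>, the two are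
  incompatible.
\<close>

lemma parametrization_slope_nonzero:
  fixes p s d :: complex and c x q :: real
  assumes c: "c > 0" and x: "x > 0" and s: "Im s > 0" and p: "Im p > 0"
    and Im_p: "Im p = q * Im s" and d: "cmod d \<le> q"
    and eq: "p * (of_real c / s + (of_real c)\<^sup>2 * p) = of_real x"
  shows "d * (of_real c / s + (of_real c)\<^sup>2 * p) + p * ((of_real c)\<^sup>2 * d - of_real c / s\<^sup>2) \<noteq> 0"
proof
  assume zero: "d * (of_real c / s + (of_real c)\<^sup>2 * p) + p * ((of_real c)\<^sup>2 * d - of_real c / s\<^sup>2) = 0"
  have s0: "s \<noteq> 0" and p0: "p \<noteq> 0"
    using s p by auto
  have q: "q > 0"
    using Im_p p s by (simp add: zero_less_mult_iff)
  have "of_real c / s + (of_real c)\<^sup>2 * p = of_real x / p"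
    using eq p0 by (simp add: field_simps)
  then have "of_real c / s = of_real x / p - of_real (c\<^sup>2) * p"
    by (simp add: algebra_simps)
  then have "Im (of_real c / s) = Im (of_real x / p - of_real (c\<^sup>2) * p)"
    by simp
  then have "- (c * Im s / (cmod s)\<^sup>2) = - (x * Im p / (cmod p)\<^sup>2) - c\<^sup>2 * Im p"
    by (simp add: Im_divide cmod_power2 del: of_real_power)
  then have "c * Im s / (cmod s)\<^sup>2 = q * Im s * (x + c\<^sup>2 * (cmod p)\<^sup>2) / (cmod p)\<^sup>2"
    using p0 by (simp add: Im_p field_simps)
  then have "Im s * (c * (cmod p)\<^sup>2) = Im s * (q * (cmod s)\<^sup>2 * (x + c\<^sup>2 * (cmod p)\<^sup>2))"
    using s0 p0 by (simp add: field_simps)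
  then have balance: "c * (cmod p)\<^sup>2 = q * (cmod s)\<^sup>2 * (x + c\<^sup>2 * (cmod p)\<^sup>2)"
    using s by simp
  have "d * s\<^sup>2 * (of_real x + (of_real c * p)\<^sup>2) - of_real c * p\<^sup>2
      = s\<^sup>2 * p * (d * (of_real c / s + (of_real c)\<^sup>2 * p) + p * ((of_real c)\<^sup>2 * d - of_real c / s\<^sup>2))"
    unfolding eq[symmetric] using s0 by (simp add: field_simps power2_eq_square)
  then have "of_real c * p\<^sup>2 = d * s\<^sup>2 * (of_real x + (of_real c * p)\<^sup>2)"
    by (simp add: zero)
  then have "cmod (of_real c * p\<^sup>2) = cmod (d * s\<^sup>2 * (of_real x + (of_real c * p)\<^sup>2))"
    by simp
  then have "c * (cmod p)\<^sup>2 = cmod d * (cmod s)\<^sup>2 * cmod (of_real x + (of_real c * p)\<^sup>2)"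
    using c by (simp add: norm_mult norm_power)
  also have "\<dots> \<le> q * (cmod s)\<^sup>2 * cmod (of_real x + (of_real c * p)\<^sup>2)"
    using d by (intro mult_right_mono) auto
  also have "\<dots> < q * (cmod s)\<^sup>2 * (x + (cmod (of_real c * p))\<^sup>2)"
    using q s0 c p x by (intro mult_strict_left_mono cmod_real_add_square_less) auto
  also have "\<dots> = q * (cmod s)\<^sup>2 * (x + c\<^sup>2 * (cmod p)\<^sup>2)"
    by (simp add: norm_mult power_mult_distrib)
  finally show False
    using balance by simp
qed

lemma deriv_inverse_parametrization_nonzero:
  fixes R :: "complex ^ 'm ^ 'm"
  assumes herm: "hermitian R" and c: "c > 0" and x: "x > 0" and s: "Im s > 0"
    and p: "Im (neg_mean_trace R s) > 0"
    and eq: "inverse_parametrization c R s = of_real x"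
  shows "deriv (inverse_parametrization c R) s \<noteq> 0"
proof -
  define d where "d = deriv (neg_mean_trace R) s"
  have [derivative_intros]: "(neg_mean_trace R has_field_derivative d) (at s)"
    unfolding d_def
    by (rule holomorphic_derivI[OF neg_mean_trace_holomorphic[OF herm] open_halfspace_Im_gt[of 0]])
       (use s in simp)
  have s0: "s \<noteq> 0"
    using s by auto
  have "(inverse_parametrization c R has_field_derivative
      d * (of_real c / s + (of_real c)\<^sup>2 * neg_mean_trace R s)
        + neg_mean_trace R s * ((of_real c)\<^sup>2 * d - of_real c / s\<^sup>2)) (at s)"
    unfolding inverse_parametrization_def using s0
    by (auto intro!: derivative_eq_intros simp: power2_eq_square field_simps)
  moreover have "d * (of_real c / s + (of_real c)\<^sup>2 * neg_mean_trace R s)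
        + neg_mean_trace R s * ((of_real c)\<^sup>2 * d - of_real c / s\<^sup>2) \<noteq> 0"
    using parametrization_slope_nonzero[OF c x s p Im_neg_mean_trace[OF herm s], of d]
      norm_deriv_neg_mean_trace_le[OF herm s] eq
    by (simp add: d_def inverse_parametrization_def)
  ultimately show ?thesis
    using DERIV_imp_deriv by metis
qed

section \<open>Analytic continuation across the real axis\<close>

lemma of_real_islimpt_upper_half_plane: "of_real x islimpt upper_half_plane"
  unfolding islimpt_approachable
proof (intro allI impI)
  fix e :: real
  assume "e > 0"
  then have "dist (Complex x (e / 2)) (of_real x) < e"
    by (simp add: dist_norm cmod_def complex_of_real_def)
  with \<open>e > 0\<close> show "\<exists>z\<in>upper_half_plane. z \<noteq> of_real x \<and> dist z (of_real x) < e"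
    by (intro bexI[of _ "Complex x (e / 2)"]) (auto simp: upper_half_plane_def complex_eq_iff)
qed

text \<open>
  The continuation is \<open>T(z) = p(Z\<^sup>-\<^sup>1(z)) / z\<close>. A local inverse of \<open>Z\<close> at \<open>s\<^sub>0\<close> recovers the parameter
  \<open>s(z)\<close> of \<open>t(z)\<close> only when \<open>s(z)\<close> lies in the neighbourhood on which \<open>Z\<close> is injective; the
  convergence \<open>s(z) \<rightarrow> s\<^sub>0\<close> guarantees this for \<open>z\<close> close to \<open>x\<^sub>0\<close>.
\<close>

lemma analytic_continuation_at_real_point:
  fixes R :: "complex ^ 'm ^ 'm" and t :: "complex \<Rightarrow> complex"
  assumes herm: "hermitian R" and c: "c > 0" and x0: "x0 > 0"
    and sol: "\<And>z. z \<in> upper_half_plane \<Longrightarrow> is_solution c R z (t z)"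
    and lim: "(t \<longlongrightarrow> w0) (at (of_real x0) within upper_half_plane)"
    and w0: "Im w0 > 0"
  obtains T \<epsilon> where "\<epsilon> > 0" and "T holomorphic_on ball (of_real x0) \<epsilon>"
    and "\<And>z. z \<in> ball (of_real x0) \<epsilon> \<inter> upper_half_plane \<Longrightarrow> t z = T z"
proof -
  define F where "F = at (complex_of_real x0) within upper_half_plane"
  define p where "p = neg_mean_trace R"
  define Z where "Z = inverse_parametrization c R"
  define s where "s = (\<lambda>z. spectral_parameter c z (t z))"
  define s0 where "s0 = spectral_parameter c (of_real x0) w0"
  have xw0: "Im (of_real x0 * w0) > 0"
    using x0 w0 by simp
  have F: "F \<noteq> bot"
    unfolding F_def trivial_limit_within by (simp add: of_real_islimpt_upper_half_plane)
  have s0: "Im s0 > 0"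
    unfolding s0_def by (rule spectral_parameter(2)[OF c w0 xw0])
  have lim_z: "((\<lambda>z. z) \<longlongrightarrow> of_real x0) F"
    unfolding F_def by (rule tendsto_ident_at)
  have lim_t: "(t \<longlongrightarrow> w0) F"
    unfolding F_def by (rule lim)
  have lim_s: "(s \<longlongrightarrow> s0) F"
    unfolding s_def s0_def spectral_parameter_def
    by (intro tendsto_intros lim_z lim_t spectral_parameter(1)[OF c w0 xw0])
  have t: "Im (t z) > 0" "Im (z * t z) > 0" "z * t z = p (s z)" if "z \<in> upper_half_plane" for z
    using sol[OF that] is_solution_imp_neg_mean_trace[OF herm c sol[OF that]]
    by (auto simp: is_solution_def upper_half_plane_def p_def s_def)
  then have Zs: "Z (s z) = z" if "z \<in> upper_half_plane" for z
    unfolding Z_def s_def using that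
    by (intro inverse_parametrization_spectral_parameter c) (auto simp: p_def s_def)
  have p_hol: "p holomorphic_on {s. Im s > 0}"
    unfolding p_def by (rule neg_mean_trace_holomorphic[OF herm])
  have p_s0: "of_real x0 * w0 = p s0"
  proof (rule tendsto_unique[OF F])
    show "((\<lambda>z. z * t z) \<longlongrightarrow> of_real x0 * w0) F"
      by (intro tendsto_intros lim_z lim_t)
    have "isCont p s0"
      using p_hol s0 open_halfspace_Im_gt[of 0]
      by (auto simp: continuous_on_eq_continuous_at dest!: holomorphic_on_imp_continuous_on)
    then have "((\<lambda>z. p (s z)) \<longlongrightarrow> p s0) F"
      using lim_s by (rule isCont_tendsto_compose)
    moreover have "eventually (\<lambda>z. p (s z) = z * t z) F"
      unfolding F_def eventually_at_filter using t(3) by (intro always_eventually) auto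
    ultimately show "((\<lambda>z. z * t z) \<longlongrightarrow> p s0) F"
      by (rule Lim_transform_eventually)
  qed
  have Z_s0: "Z s0 = of_real x0"
    unfolding Z_def s0_def
    by (rule inverse_parametrization_spectral_parameter[OF c w0 xw0])
       (use p_s0 in \<open>simp add: p_def s0_def\<close>)
  have Z_hol: "Z holomorphic_on {s. Im s > 0}"
    unfolding Z_def by (rule inverse_parametrization_holomorphic[OF herm])
  have "deriv Z s0 \<noteq> 0"
    unfolding Z_def
    by (rule deriv_inverse_parametrization_nonzero[OF herm c x0 s0])
       (use p_s0 xw0 Z_s0 in \<open>simp_all add: p_def Z_def flip: p_s0\<close>)
  then obtain r where r: "r > 0" "ball s0 r \<subseteq> {s. Im s > 0}" "open (Z ` ball s0 r)" "inj_on Z (ball s0 r)"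
    using has_complex_derivative_locally_invertible[OF Z_hol _ open_halfspace_Im_gt] s0 by blast
  obtain g where g: "g holomorphic_on Z ` ball s0 r" "\<And>u. u \<in> ball s0 r \<Longrightarrow> g (Z u) = u"
    using holomorphic_has_inverse[OF holomorphic_on_subset[OF Z_hol r(2)] open_ball r(4)] by metis
  have "of_real x0 \<in> Z ` ball s0 r"
    using Z_s0 r(1) by (metis centre_in_ball imageI)
  then obtain e where e: "e > 0" "ball (of_real x0) e \<subseteq> Z ` ball s0 r"
    using r(3) open_contains_ball by metis
  have "eventually (\<lambda>z. s z \<in> ball s0 r) F"
    using lim_s r(1) by (intro topological_tendstoD) auto
  then obtain e' where e': "e' > 0"
    "\<And>z. z \<in> upper_half_plane \<Longrightarrow> z \<noteq> of_real x0 \<Longrightarrow> dist z (of_real x0) < e' \<Longrightarrow> s z \<in> ball s0 r"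
    unfolding F_def eventually_at by metis
  \<comment> \<open>The bound \<open>x0\<close> keeps the disc away from the origin, where \<open>T\<close> divides by zero.\<close>
  define \<epsilon> where "\<epsilon> = min x0 (min e e')"
  define T where "T = (\<lambda>z. p (g z) / z)"
  show thesis
  proof
    show "\<epsilon> > 0"
      using x0 e e' by (simp add: \<epsilon>_def)
    have sub: "ball (of_real x0) \<epsilon> \<subseteq> Z ` ball s0 r"
      using e(2) by (auto simp: \<epsilon>_def)
    have "g ` ball (of_real x0) \<epsilon> \<subseteq> {s. Im s > 0}"
      using sub g(2) r(2) by fastforce
    moreover have "z \<noteq> 0" if "z \<in> ball (of_real x0) \<epsilon>" for z :: complex
      using that x0 by (auto simp: \<epsilon>_def)
    ultimately show "T holomorphic_on ball (of_real x0) \<epsilon>"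
      unfolding T_def
      by (intro holomorphic_intros holomorphic_on_compose_gen[OF _ p_hol, unfolded o_def]
          holomorphic_on_subset[OF g(1) sub]) auto
    fix z
    assume z: "z \<in> ball (of_real x0) \<epsilon> \<inter> upper_half_plane"
    then have "z \<noteq> of_real x0" and z0: "z \<noteq> 0"
      by (auto simp: upper_half_plane_def)
    then have "s z \<in> ball s0 r"
      using z e'(2)[of z] by (simp add: \<epsilon>_def dist_commute)
    then have "g z = s z"
      using g(2)[of "s z"] Zs[of z] z by simp
    then show "t z = T z"
      using t(3)[of z] z z0 by (simp add: T_def field_simps)
  qed
qed

section \<open>Power series expansions of the transform and the density\<close>

theorem proposition9:
  fixes R :: "complex ^ 'm ^ 'm"
    and N L :: nat
    and a b c x0 :: real
    and t :: "complex \<Rightarrow> complex"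
    and f :: "real \<Rightarrow> real"
  assumes "N \<ge> 1" and "L \<ge> 1"
    and c_eq: "c = real CARD('m) * real L / real N"
    and "0 < a" and "a < b"
    and "hermitian R"
    and "loewner_le (mat (of_real a)) R"
    and "loewner_less R (mat (of_real b))"
    and t_unique_solution:
      "\<And>z. z \<in> upper_half_plane \<Longrightarrow> \<forall>w. is_solution c R z w \<longleftrightarrow> w = t z"
    and t_boundary:
      "\<And>x::real. x > 0 \<Longrightarrow> (t \<longlongrightarrow> t (of_real x)) (at (of_real x) within upper_half_plane)"
    and f_eq: "\<And>x. x > 0 \<Longrightarrow> f x = 1 / pi * Im (t (of_real x))"
    and "x0 > 0" and "Im (t (of_real x0)) > 0"
  shows "\<exists>(A :: nat \<Rightarrow> complex) (B :: nat \<Rightarrow> real). \<exists>\<epsilon>>0. \<forall>x::real. \<bar>x - x0\<bar> < \<epsilon> \<longrightarrow>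
           (\<lambda>k. A k * of_real (x - x0) ^ k) sums t (of_real x) \<and>
           (\<lambda>k. B k * (x - x0) ^ k) sums f x"
proof -
  have "c > 0"
    using \<open>N \<ge> 1\<close> \<open>L \<ge> 1\<close> by (simp add: c_eq)
  moreover have "is_solution c R z (t z)" if "z \<in> upper_half_plane" for z
    using t_unique_solution[OF that] by blast
  ultimately obtain T e where T: "e > 0" "T holomorphic_on ball (of_real x0) e"
    "\<And>z. z \<in> ball (of_real x0) e \<inter> upper_half_plane \<Longrightarrow> t z = T z"
    using analytic_continuation_at_real_point[OF \<open>hermitian R\<close> _ \<open>x0 > 0\<close> _
        t_boundary[OF \<open>x0 > 0\<close>] \<open>Im (t (of_real x0)) > 0\<close>] by metis
  define A where "A = (\<lambda>k. (deriv ^^ k) T (of_real x0) / fact k)"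
  define B where "B = (\<lambda>k. 1 / pi * Im (A k))"
  have "(\<lambda>k. A k * of_real (x - x0) ^ k) sums t (of_real x) \<and> (\<lambda>k. B k * (x - x0) ^ k) sums f x"
    if x: "\<bar>x - x0\<bar> < min e x0" for x
  proof -
    have "x > 0"
      using x by linarith
    have x_ball: "complex_of_real x \<in> ball (of_real x0) e"
      using x by (simp add: dist_norm abs_minus_commute flip: of_real_diff)
    \<comment> \<open>On the real axis only the limit from above relates \<open>t\<close> to \<open>T\<close>.\<close>
    have "t (of_real x) = T (of_real x)"
    proof (rule tendsto_unique)
      show "at (complex_of_real x) within upper_half_plane \<noteq> bot"
        unfolding trivial_limit_within by (simp add: of_real_islimpt_upper_half_plane)
      show "(t \<longlongrightarrow> t (of_real x)) (at (of_real x) within upper_half_plane)"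
        by (rule t_boundary[OF \<open>x > 0\<close>])
      have "isCont T (of_real x)"
        using holomorphic_on_imp_continuous_on[OF T(2)] x_ball
        by (simp add: continuous_on_eq_continuous_at)
      then have "(T \<longlongrightarrow> T (of_real x)) (at (of_real x) within upper_half_plane)"
        unfolding isCont_def by (rule tendsto_within_subset) simp
      moreover have "eventually (\<lambda>z. T z = t z) (at (of_real x) within upper_half_plane)"
        unfolding eventually_at_topological using x_ball T(3)
        by (intro exI[of _ "ball (of_real x0) e"]) auto
      ultimately show "(t \<longlongrightarrow> T (of_real x)) (at (of_real x) within upper_half_plane)"
        by (rule Lim_transform_eventually)
    qed
    then have A: "(\<lambda>k. A k * of_real (x - x0) ^ k) sums t (of_real x)"
      using holomorphic_power_series[OF T(2) x_ball] by (simp add: A_def)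
    then have "(\<lambda>k. 1 / pi * Im (A k * of_real ((x - x0) ^ k))) sums (1 / pi * Im (t (of_real x)))"
      by (intro sums_mult sums_Im) simp
    moreover have "1 / pi * Im (A k * of_real ((x - x0) ^ k)) = B k * (x - x0) ^ k" for k
      by (simp add: B_def del: of_real_power)
    ultimately show ?thesis
      using A f_eq[OF \<open>x > 0\<close>] by simp
  qed
  moreover have "min e x0 > 0"
    using T(1) \<open>x0 > 0\<close> by simp
  ultimately show ?thesis
    by blast
qed

end
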